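(* For every $n \ge 1$, the rank generating polynomial of the absolute order $\mathrm{Abs}(\mathcal{M}_n)$ on perfect matchings satisfies $$(\mathcal{M}_n)_T(q) \ = \ \prod_{i=0}^{n-1} (1 + 2iq).$$
   Context: $\mathcal{M}_n$ is the set of perfect matchings of $\Omega_n = \{1,-1,2,-2,\dots,n,-n\}$, i.e. partitions of $\Omega_n$ into two-element subsets. $\Delta_n$ is the simple graph on the node set $\mathcal{M}_n$ in which two perfect matchings are adjacent if their symmetric difference is a cycle of length 4. Fix $x_0 = \{\{-1,1\},\{-2,2\},\dots,\{-n,n\}\}$. The absolute order $\mathrm{Abs}(\mathcal{M}_n)$ is the partial order on $\mathcal{M}_n$ in which $x \preceq y$ iff $x$ lies in a geodesic path in $\Delta_n$ with endpoints $x_0$ and $y$. The rank (absolute length) $\ell_T(x)$ of $x \in \mathcal{M}_n$ is the distance from $x_0$ to $x$ in $\Delta_n$; equivalently, it is the minimum number $k$ of transpositions $t_1,\dots,t_k$ in the symmetric group $S_{2n}$ of permutations of $\Omega_n$ with $x = t_1 \cdots t_k x_0$. The rank generating polynomial is $(\mathcal{M}_n)_T(q) := \sum_{x \in \mathcal{M}_n} q^{\ell_T(x)}$. *)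

theory Defs
  imports
    "Graph_Theory.Graph_Theory"
    "HOL-Library.Disjoint_Sets"
    "HOL-Computational_Algebra.Polynomial"
begin

definition Omega :: "nat \<Rightarrow> int set" where
  "Omega n = {- int n..-1} \<union> {1..int n}"

definition perfect_matchings :: "nat \<Rightarrow> int set set set" where
  "perfect_matchings n = {x. partition_on (Omega n) x \<and> (\<forall>e\<in>x. card e = 2)}"

text \<open>A set of edges is a cycle of length \<open>k\<close> if it consists of the edges joining cyclically
  consecutive members of a sequence of \<open>k \<ge> 3\<close> distinct nodes.\<close>

definition is_cycle_of_length :: "nat \<Rightarrow> 'a set set \<Rightarrow> bool" where
  "is_cycle_of_length k F \<longleftrightarrow> k \<ge> 3 \<and>
     (\<exists>vs. length vs = k \<and> distinct vs \<and> F = {{vs ! i, vs ! (Suc i mod k)} | i. i < k})"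

text \<open>Undirected simple graphs are rendered as symmetric loop-free digraphs without parallel
  arcs, the locale \<open>pair_graph\<close>.\<close>

definition matching_graph :: "nat \<Rightarrow> int set set pair_pre_digraph" where
  "matching_graph n =
     \<lparr> pverts = perfect_matchings n,
       parcs = {(x, y). x \<in> perfect_matchings n \<and> y \<in> perfect_matchings n \<and>
                        is_cycle_of_length 4 (sym_diff x y)} \<rparr>"

text \<open>Only meaningful if \<open>v\<close> is reachable from \<open>u\<close>; otherwise the value is an unspecified
  number.\<close>

definition graph_dist :: "('a, 'b) pre_digraph \<Rightarrow> 'a \<Rightarrow> 'a \<Rightarrow> nat" where
  "graph_dist G u v = (LEAST k. \<exists>p. pre_digraph.awalk G u p v \<and> length p = k)"

definition geodesic :: "('a, 'b) pre_digraph \<Rightarrow> 'a \<Rightarrow> 'b awalk \<Rightarrow> 'a \<Rightarrow> bool" where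
  "geodesic G u p v \<longleftrightarrow> pre_digraph.apath G u p v \<and> length p = graph_dist G u v"

definition base_matching :: "nat \<Rightarrow> int set set" where
  "base_matching n = (\<lambda>k. {- k, k}) ` {1..int n}"

definition absolute_order :: "nat \<Rightarrow> int set set rel" where
  "absolute_order n =
     {(x, y). x \<in> perfect_matchings n \<and> y \<in> perfect_matchings n \<and>
        (\<exists>p. geodesic (with_proj (matching_graph n)) (base_matching n) p y \<and>
             x \<in> set (pre_digraph.awalk_verts (with_proj (matching_graph n)) (base_matching n) p))}"

definition absolute_length :: "nat \<Rightarrow> int set set \<Rightarrow> nat" where
  "absolute_length n x = graph_dist (with_proj (matching_graph n)) (base_matching n) x"

definition rank_generating_poly :: "nat \<Rightarrow> int poly" where
  "rank_generating_poly n = (\<Sum>x\<in>perfect_matchings n. monom 1 (absolute_length n x))"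


lemma finite_perfect_matchings: "finite (perfect_matchings n)"
proof (rule finite_subset)
  show "perfect_matchings n \<subseteq> Pow (Pow (Omega n))"
    by (auto simp: perfect_matchings_def partition_on_def)
  show "finite (Pow (Pow (Omega n)))"
    by (simp add: Omega_def)
qed

lemma base_matching_in_perfect_matchings: "base_matching n \<in> perfect_matchings n"
proof -
  have "\<Union>(base_matching n) = Omega n"
  proof
    show "Omega n \<subseteq> \<Union>(base_matching n)"
    proof
      fix a assume "a \<in> Omega n"
      then have "\<bar>a\<bar> \<in> {1..int n}" "a \<in> {- \<bar>a\<bar>, \<bar>a\<bar>}"
        by (auto simp: Omega_def)
      then show "a \<in> \<Union>(base_matching n)"
        unfolding base_matching_def by blast
    qed
  qed (auto simp: base_matching_def Omega_def)
  moreover have "disjoint (base_matching n)"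
    by (auto simp: base_matching_def disjoint_def)
  moreover have "\<forall>e\<in>base_matching n. card e = 2" "{} \<notin> base_matching n"
    by (auto simp: base_matching_def)
  ultimately show ?thesis
    by (simp add: perfect_matchings_def partition_on_def)
qed

lemma pair_graph_matching_graph: "pair_graph (matching_graph n)"
proof unfold_locales
  show "finite (parcs (matching_graph n))"
    by (rule finite_subset[of _ "perfect_matchings n \<times> perfect_matchings n"])
      (auto simp: matching_graph_def finite_perfect_matchings)
  show "symmetric (with_proj (matching_graph n))"
    by (auto simp: symmetric_def sym_def matching_graph_def Un_commute)
  have no_empty: "\<not> is_cycle_of_length 4 ({} :: int set set)"
    by (force simp: is_cycle_of_length_def)
  then show "fst e \<noteq> snd e" if "e \<in> parcs (matching_graph n)" for e
    using that by (auto simp: matching_graph_def)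
qed (auto simp: matching_graph_def finite_perfect_matchings)

text \<open>On reachable pairs, the distance is the library's shortest-path distance for unit
  weights.\<close>

lemma (in wf_digraph) graph_dist_eq_mu:
  assumes "u \<rightarrow>\<^sup>* v"
  shows "\<mu> (\<lambda>_. 1) u v = ereal (real (graph_dist G u v))"
proof -
  have cost: "awalk_cost (\<lambda>_. 1) p = real (length p)" for p
    by (induction p) auto
  have "\<exists>k p. awalk u p v \<and> length p = k"
    using assms by (simp add: reachable_awalk)
  then have "\<exists>p. awalk u p v \<and> length p = graph_dist G u v"
    unfolding graph_dist_def by (rule LeastI_ex)
  then obtain p where p: "awalk u p v" "length p = graph_dist G u v" by blast
  have least: "graph_dist G u v \<le> length q" if "awalk u q v" for q
    unfolding graph_dist_def using that by (intro Least_le) blast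
  show ?thesis
    unfolding \<mu>_def cost
  proof (rule antisym)
    show "(INF p\<in>{p. awalk u p v}. ereal (real (length p))) \<le> ereal (real (graph_dist G u v))"
      using p by (intro INF_lower2[of p]) auto
    show "ereal (real (graph_dist G u v)) \<le> (INF p\<in>{p. awalk u p v}. ereal (real (length p)))"
      using least by (intro INF_greatest) auto
  qed
qed

end

theory Submission
  imports Defs "HOL-Combinatorics.Transposition"
begin

text \<open>Two perfect matchings are adjacent iff they differ and a transposition of \<open>S\<close> carries one
  to the other. If \<open>N, M\<close> are two new points, every perfect matching of
  \<open>S \<union> {N, M}\<close> is obtained in a unique way from a perfect matching \<open>y\<close> of \<open>S\<close> and a partner
  \<open>p \<in> S \<union> {M}\<close> of \<open>N\<close>: apply the transposition of \<open>p\<close> and \<open>M\<close> to \<open>y \<union> {{N, M}}\<close>. The distance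
  from the base matching is that of \<open>y\<close>, plus one if \<open>p \<noteq> M\<close>, because this function vanishes
  only at the base matching, changes by at most one under a transposition, and can be lowered by some
  transposition wherever it is positive. Hence adding two points to \<open>S\<close> multiplies the rank
  generating polynomial by \<open>1 + card S * q\<close>.\<close>

section \<open>Perfect matchings of an arbitrary set and the action of transpositions on
  them\<close>

text \<open>Generalizes \<open>perfect_matchings\<close> to an arbitrary ground set, so that two
  points can be added without reference to integers.\<close>

definition matchings :: "'a set \<Rightarrow> 'a set set set" where
  "matchings S = {x. partition_on S x \<and> (\<forall>e\<in>x. card e = 2)}"

definition swap :: "'a \<Rightarrow> 'a \<Rightarrow> 'a set set \<Rightarrow> 'a set set" where
  "swap a c x = (`) (transpose a c) ` x"

lemma swap_swap [simp]: "swap a c (swap a c x) = x"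
  by (simp add: swap_def image_image)

lemma swap_same [simp]: "swap a a x = x"
  by (simp add: swap_def)

lemma swap_commute: "swap a c = swap c a"
  by (simp add: swap_def transpose_commute fun_eq_iff)

lemma swap_conjugate: "swap a c (swap p q x) = swap (transpose a c p) (transpose a c q) (swap a c x)"
proof -
  have "transpose a c (transpose p q z) =
      transpose (transpose a c p) (transpose a c q) (transpose a c z)" for z
    by (auto simp: transpose_def)
  then show ?thesis
    by (simp add: swap_def image_image)
qed

lemma swap_insert: "swap a c (insert e x) = insert (transpose a c ` e) (swap a c x)"
  by (simp add: swap_def)

lemma matchings_eqD:
  assumes "x \<in> matchings S" "e \<in> x" "e' \<in> x" "a \<in> e" "a \<in> e'"
  shows "e = e'"
  using assms by (auto simp: matchings_def partition_on_def disjoint_def)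

lemma matchings_partner_unique:
  assumes "x \<in> matchings S" "{a, b} \<in> x" "{a, b'} \<in> x"
  shows "b = b'"
  using matchings_eqD[OF assms, of a] by (auto simp: doubleton_eq_iff)

lemma matchings_edgeD:
  assumes "x \<in> matchings S" "{a, b} \<in> x"
  shows "a \<noteq> b" "a \<in> S" "b \<in> S"
  using assms by (auto simp: matchings_def partition_on_def)

lemma matchings_edgeE:
  assumes "x \<in> matchings S" "e \<in> x"
  obtains a b where "e = {a, b}" "a \<noteq> b"
  using assms by (auto simp: matchings_def card_2_iff)

lemma matchings_partner:
  assumes "x \<in> matchings S" "a \<in> S"
  obtains b where "{a, b} \<in> x"
proof -
  obtain e where e: "e \<in> x" "a \<in> e"
    using assms by (auto simp: matchings_def partition_on_def)
  then show ?thesis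
    using matchings_edgeE[OF assms(1) e(1)] that by (metis insert_iff insert_commute singletonD)
qed

lemma swap_in_matchings:
  assumes x: "x \<in> matchings S" and ac: "a \<in> S" "c \<in> S"
  shows "swap a c x \<in> matchings S"
proof -
  have inj: "inj (transpose a c)" by (rule inj_transpose)
  have "\<Union>(swap a c x) = transpose a c ` \<Union>x"
    by (auto simp: swap_def)
  also have "\<Union>x = S" using x by (simp add: matchings_def partition_on_def)
  also have "transpose a c ` S = S" using ac by simp
  finally have "\<Union>(swap a c x) = S" .
  moreover have "disjoint (swap a c x)"
    using x unfolding swap_def matchings_def partition_on_def
    by (auto intro!: disjoint_image[OF inj_on_transpose])
  moreover have "card e = 2 \<and> e \<noteq> {}" if "e \<in> swap a c x" for e
    using that x card_image[OF inj_on_subset[OF inj subset_UNIV]]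
    by (auto simp: swap_def matchings_def)
  ultimately show ?thesis
    by (auto simp: matchings_def partition_on_def)
qed

text \<open>Only the two edges meeting \<open>a\<close> or \<open>c\<close> are affected. The two
  lost and the two gained edges alternate around the 4-cycle \<open>a\<close>, \<open>b\<close>,
  \<open>c\<close>, \<open>d\<close>, which links transpositions to adjacency.\<close>

lemma swap_eq:
  assumes x: "x \<in> matchings S" and e: "{a, b} \<in> x" "{c, d} \<in> x" and "{a, b} \<noteq> {c, d}"
  shows "swap a c x = x - {{a, b}, {c, d}} \<union> {{b, c}, {d, a}}"
proof -
  have dist: "a \<noteq> b" "c \<noteq> d" "a \<noteq> c" "a \<noteq> d" "b \<noteq> c" "b \<noteq> d"
    using matchings_eqD[OF x e] matchings_edgeD[OF x e(1)] matchings_edgeD[OF x e(2)] assms(4)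
    by auto
  have rest: "transpose a c ` e = e" if "e \<in> x - {{a, b}, {c, d}}" for e
  proof -
    have "a \<notin> e" "c \<notin> e"
      using that matchings_eqD[OF x e(1), of e] matchings_eqD[OF x e(2), of e] by auto
    then show ?thesis by (auto simp: transpose_def image_iff)
  qed
  have "x = (x - {{a, b}, {c, d}}) \<union> {{a, b}, {c, d}}"
    using e by auto
  then have "swap a c x = swap a c (x - {{a, b}, {c, d}}) \<union> swap a c {{a, b}, {c, d}}"
    unfolding swap_def by (metis image_Un)
  also have "swap a c (x - {{a, b}, {c, d}}) = x - {{a, b}, {c, d}}"
    unfolding swap_def using image_cong[OF refl rest, of "x - {{a, b}, {c, d}}"] by simp
  also have "swap a c {{a, b}, {c, d}} = {{b, c}, {d, a}}"
    using dist by (auto simp: swap_def transpose_def insert_commute)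
  finally show ?thesis .
qed

text \<open>Both transpositions recombine the same two edges in the same way. If the edges coincide,
  either both transpositions are trivial or they are equal.\<close>

lemma swap_partners:
  assumes x: "x \<in> matchings S" and e: "{a, b} \<in> x" "{c, d} \<in> x"
  shows "swap a c x = swap b d x"
proof (cases "{a, b} = {c, d}")
  case True
  then show ?thesis by (auto simp: doubleton_eq_iff swap_commute)
next
  case False
  then show ?thesis
    using swap_eq[OF x e] swap_eq[OF x, of b a d c] e by (simp add: insert_commute)
qed

lemma swap_edge:
  assumes x: "x \<in> matchings S" and e: "{a, c} \<in> x"
  shows "swap a c x = x"
proof -
  have "transpose a c ` e' = e'" if "e' \<in> x" for e'
  proof (cases "e' = {a, c}")
    case False
    then have "a \<notin> e'" "c \<notin> e'"
      using matchings_eqD[OF x e that] by auto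
    then show ?thesis by (auto simp: transpose_def image_iff)
  qed auto
  then show ?thesis by (simp add: swap_def cong: image_cong)
qed

text \<open>The action is trivial if \<open>a\<close> and \<open>c\<close> are equal or matched to
  each other; otherwise their edges are distinct, hence disjoint.\<close>

lemma swap_cases:
  assumes x: "x \<in> matchings S" and ac: "a \<in> S" "c \<in> S"
  obtains "swap a c x = x"
  | b d where "{a, b} \<in> x" "{c, d} \<in> x" "distinct [a, b, c, d]"
proof -
  obtain b d where bd: "{a, b} \<in> x" "{c, d} \<in> x"
    using matchings_partner[OF x] ac by metis
  show ?thesis
  proof (cases "a = c \<or> b = c")
    case True
    then have "swap a c x = x" using swap_edge[OF x bd(1)] by (elim disjE) simp_all
    then show ?thesis by (rule that(1))
  next
    case False
    then have "{a, b} \<noteq> {c, d}" by (simp add: doubleton_eq_iff)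
    then have "{a, b} \<inter> {c, d} = {}"
      using matchings_eqD[OF x bd] by blast
    moreover have "a \<noteq> b" "c \<noteq> d"
      using matchings_edgeD[OF x] bd by blast+
    ultimately have "distinct [a, b, c, d]" by auto
    then show ?thesis by (rule that(2)[OF bd])
  qed
qed

text \<open>If \<open>u\<close> is one of \<open>a\<close>, \<open>c\<close>, the partners
  \<open>b\<close>, \<open>d\<close> serve instead by \<open>swap_partners\<close>; they differ from
  \<open>u\<close> because the four points are distinct.\<close>

lemma swap_avoiding:
  assumes x: "x \<in> matchings S" and ac: "a \<in> S" "c \<in> S"
  obtains "swap a c x = x"
  | b d where "b \<in> S - {u}" "d \<in> S - {u}" "swap a c x = swap b d x"
  using x ac
proof (cases rule: swap_cases)
  case (2 b d)
  show ?thesis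
  proof (cases "u \<in> {a, c}")
    case True
    then show ?thesis
      using 2(3) matchings_edgeD[OF x 2(1)] matchings_edgeD[OF x 2(2)]
      by (intro that(2)[OF _ _ swap_partners[OF x 2(1,2)]]) auto
  next
    case False
    then show ?thesis using ac by (intro that(2)[of a c]) auto
  qed
qed

section \<open>Adjacency as the action of a transposition\<close>

lemma four_cycle_iff:
  "is_cycle_of_length 4 F \<longleftrightarrow>
    (\<exists>a b c d. distinct [a, b, c, d] \<and> F = {{a, b}, {b, c}, {c, d}, {d, a}})"
proof -
  have cyc: "{{vs ! i, vs ! (Suc i mod 4)} |i. i < 4} = {{a, b}, {b, c}, {c, d}, {d, a}}"
    if "vs = [a, b, c, d]" for vs and a b c d :: 'a
  proof -
    have "{{vs ! i, vs ! (Suc i mod 4)} |i. i < 4} = (\<lambda>i. {vs ! i, vs ! (Suc i mod 4)}) ` {..<4}"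
      by auto
    also have "{..<4::nat} = {0, 1, 2, 3}" by auto
    finally show ?thesis using that by simp
  qed
  have len: "length vs = 4 \<longleftrightarrow> (\<exists>a b c d. vs = [a, b, c, d])" for vs :: "'a list"
    by (auto simp: length_Suc_conv numeral_eq_Suc)
  show ?thesis
    unfolding is_cycle_of_length_def len
  proof (intro iffI; elim conjE exE)
    fix vs and a b c d :: 'a
    assume "vs = [a, b, c, d]" "distinct vs" "F = {{vs ! i, vs ! (Suc i mod 4)} |i. i < 4}"
    then have "distinct [a, b, c, d] \<and> F = {{a, b}, {b, c}, {c, d}, {d, a}}"
      using cyc[OF \<open>vs = _\<close>] by simp
    then show "\<exists>a b c d. distinct [a, b, c, d] \<and> F = {{a, b}, {b, c}, {c, d}, {d, a}}"
      by blast
  next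
    fix a b c d
    assume *: "distinct [a, b, c, d]" "F = {{a, b}, {b, c}, {c, d}, {d, a}}"
    have "(\<exists>a' b' c' d'. [a, b, c, d] = [a', b', c', d']) \<and> distinct [a, b, c, d] \<and>
        F = {{[a, b, c, d] ! i, [a, b, c, d] ! (Suc i mod 4)} |i. i < 4}"
      using * unfolding cyc[OF refl] by blast
    then show "4 \<ge> (3::nat) \<and> (\<exists>vs. (\<exists>a b c d. vs = [a, b, c, d]) \<and> distinct vs \<and>
        F = {{vs ! i, vs ! (Suc i mod 4)} |i. i < 4})"
      by (intro conjI exI[of _ "[a, b, c, d]"]) simp_all
  qed
qed

text \<open>Consecutive edges of the cycle share a node, so no matching contains both; the edges
  therefore alternate between \<open>x\<close> and \<open>y\<close>, which is the situation of
  \<open>swap_eq\<close>.\<close>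

lemma adjacent_imp_swap:
  assumes x: "x \<in> matchings S" and y: "y \<in> matchings S"
    and cyc: "is_cycle_of_length 4 (sym_diff x y)"
  obtains a c where "a \<in> S" "c \<in> S" "y = swap a c x"
proof -
  have key: "\<exists>a\<in>S. \<exists>c\<in>S. y = swap a c x"
    if d: "distinct [a, b, c, d]" and F: "sym_diff x y = {{a, b}, {b, c}, {c, d}, {d, a}}"
      and ab: "{a, b} \<in> x" for a b c d
  proof -
    have ne: "{b, c} \<noteq> {a, b}" "{b, c} \<noteq> {c, d}" "{a, b} \<noteq> {c, d}"
      "{d, a} \<noteq> {a, b}" "{d, a} \<noteq> {c, d}" "{b, c} \<noteq> {d, a}"
      using d by (auto simp: doubleton_eq_iff)
    have "{b, c} \<notin> x"
      using matchings_eqD[OF x ab, of "{b, c}" b] ne by blast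
    then have bc: "{b, c} \<in> y" using F by blast
    then have "{c, d} \<notin> y"
      using matchings_eqD[OF y, of "{b, c}" "{c, d}" c] ne by blast
    then have cd: "{c, d} \<in> x" using F by blast
    have "{d, a} \<notin> x"
      using matchings_eqD[OF x ab, of "{d, a}" a] ne by blast
    then have da: "{d, a} \<in> y" using F by blast
    have "{a, b} \<notin> y"
      using matchings_eqD[OF y bc, of "{a, b}" b] ne by blast
    with F bc cd da \<open>{c, d} \<notin> y\<close> ab \<open>{b, c} \<notin> x\<close> \<open>{d, a} \<notin> x\<close>
    have "x - y = {{a, b}, {c, d}}" "y - x = {{b, c}, {d, a}}"
      by auto
    then have "y = x - {{a, b}, {c, d}} \<union> {{b, c}, {d, a}}" by blast
    then have "y = swap a c x"
      using swap_eq[OF x ab cd ne(3)] by simp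
    then show ?thesis
      using matchings_edgeD[OF x ab] matchings_edgeD[OF x cd] by blast
  qed
  obtain a b c d where *: "distinct [a, b, c, d]"
      "sym_diff x y = {{a, b}, {b, c}, {c, d}, {d, a}}"
    using cyc unfolding four_cycle_iff by blast
  show ?thesis
  proof (cases "{a, b} \<in> x")
    case True
    then show ?thesis using key[OF *] that by blast
  next
    case False
    \<comment> \<open>The next edge of the cycle then lies in \<open>x\<close>, so
      \<open>key\<close> applies after rotating the cycle by one node.\<close>
    then have ab: "{a, b} \<in> y" using * by blast
    have "{b, c} \<noteq> {a, b}" using * by (auto simp: doubleton_eq_iff)
    then have "{b, c} \<notin> y"
      using matchings_eqD[OF y ab, of "{b, c}" b] by blast
    then have bc: "{b, c} \<in> x" using * by blast
    have F: "sym_diff x y = {{b, c}, {c, d}, {d, a}, {a, b}}"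
      using * by (simp add: insert_commute)
    have "distinct [b, c, d, a]" using * by auto
    from key[OF this F bc] show ?thesis using that by blast
  qed
qed

lemma swap_imp_adjacent:
  assumes x: "x \<in> matchings S" and ac: "a \<in> S" "c \<in> S" and ne: "swap a c x \<noteq> x"
  shows "is_cycle_of_length 4 (sym_diff x (swap a c x))"
  using x ac
proof (cases rule: swap_cases)
  case (2 b d)
  have "{a, b} \<noteq> {c, d}" "{b, c} \<noteq> {a, b}" "{d, a} \<noteq> {a, b}"
    using 2 by (auto simp: doubleton_eq_iff)
  moreover from this have "{b, c} \<notin> x" "{d, a} \<notin> x"
    using matchings_eqD[OF x 2(1), of "{b, c}" b] matchings_eqD[OF x 2(1), of "{d, a}" a]
    by auto
  ultimately have "x - swap a c x = {{a, b}, {c, d}}" "swap a c x - x = {{b, c}, {d, a}}"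
    unfolding swap_eq[OF x 2(1,2) \<open>{a, b} \<noteq> {c, d}\<close>] using 2(1,2) by auto
  then have "sym_diff x (swap a c x) = {{a, b}, {b, c}, {c, d}, {d, a}}" by auto
  then show ?thesis unfolding four_cycle_iff using 2(3) by blast
qed (use ne in simp)

section \<open>Recognizing the distance function\<close>

text \<open>Axioms for the distance from \<open>b\<close> under transpositions: the step bound makes
  \<open>f\<close> a lower bound for walk lengths, the descent condition makes it an upper bound for
  the distance.\<close>

definition swap_rank :: "'a set \<Rightarrow> 'a set set \<Rightarrow> ('a set set \<Rightarrow> nat) \<Rightarrow> bool" where
  "swap_rank S b f \<longleftrightarrow> b \<in> matchings S \<and> (\<forall>x\<in>matchings S.
     (f x = 0 \<longleftrightarrow> x = b) \<and>
     (\<forall>a\<in>S. \<forall>c\<in>S. f (swap a c x) \<le> f x + 1) \<and>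
     (f x > 0 \<longrightarrow> (\<exists>a\<in>S. \<exists>c\<in>S. f (swap a c x) < f x)))"

lemma absolute_length_eq_swap_rank:
  assumes f: "swap_rank (Omega n) (base_matching n) f" and x: "x \<in> perfect_matchings n"
  shows "absolute_length n x = f x"
proof -
  interpret pair_graph "matching_graph n" by (rule pair_graph_matching_graph)
  let ?b = "base_matching n"
  have pm: "perfect_matchings n = matchings (Omega n)"
    by (simp add: perfect_matchings_def matchings_def)
  have arcD: "f z \<le> f y + 1" if "(y, z) \<in> parcs (matching_graph n)" for y z
  proof -
    have yz: "y \<in> matchings (Omega n)" "z \<in> matchings (Omega n)"
        "is_cycle_of_length 4 (sym_diff y z)"
      using that by (auto simp: matching_graph_def pm)
    show ?thesis
      using f yz adjacent_imp_swap[OF yz] unfolding swap_rank_def by metis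
  qed
  have lower: "f v \<le> f u + length p" if "awalk u p v" for u p v
    using that
  proof (induction p arbitrary: u)
    case Nil
    then show ?case by (simp add: awalk_Nil_iff)
  next
    case (Cons e p)
    then have "(u, snd e) \<in> parcs (matching_graph n)" "awalk (snd e) p v"
      by (auto simp: awalk_Cons_iff)
    with Cons.IH[of "snd e"] arcD[of u "snd e"] show ?case by simp
  qed
  \<comment> \<open>Descent along \<open>f\<close> can stop only where \<open>f\<close> vanishes,
    which is at the base matching; reading the descent backwards gives the walk.\<close>
  have upper: "\<exists>p. awalk ?b p x \<and> length p \<le> f x" if "x \<in> matchings (Omega n)" for x
    using that
  proof (induction "f x" arbitrary: x rule: less_induct)
    case less
    show ?case
    proof (cases "f x = 0")
      case True
      then have "x = ?b" using f less.prems unfolding swap_rank_def by blast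
      moreover have "?b \<in> pverts (matching_graph n)"
        by (simp add: matching_graph_def base_matching_in_perfect_matchings)
      ultimately have "awalk ?b [] x" by (simp add: awalk_Nil_iff)
      then show ?thesis by force
    next
      case False
      then obtain a c where ac: "a \<in> Omega n" "c \<in> Omega n" "f (swap a c x) < f x"
        using f less.prems unfolding swap_rank_def by blast
      let ?y = "swap a c x"
      have y: "?y \<in> matchings (Omega n)"
        using swap_in_matchings[OF less.prems ac(1,2)] .
      then obtain p where p: "awalk ?b p ?y" "length p \<le> f ?y"
        using less.hyps[OF ac(3)] by blast
      \<comment> \<open>The strict decrease of \<open>f\<close> rules out \<open>?y = x\<close>, so
        the transposition yields a genuine arc.\<close>
      have "is_cycle_of_length 4 (sym_diff x ?y)"
        using swap_imp_adjacent[OF less.prems ac(1,2)] ac(3) by force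
      then have "(?y, x) \<in> parcs (matching_graph n)"
        using y less.prems by (auto simp: matching_graph_def pm Un_commute)
      then have "awalk ?y [(?y, x)] x"
        using arc_implies_awalk by force
      then have "awalk ?b (p @ [(?y, x)]) x"
        using p awalk_appendI by blast
      moreover have "length (p @ [(?y, x)]) \<le> f x" using p ac by simp
      ultimately show ?thesis by blast
    qed
  qed
  have fb: "f ?b = 0"
    using f unfolding swap_rank_def by blast
  obtain p where p: "awalk ?b p x" "length p \<le> f x" using upper x unfolding pm by blast
  show ?thesis
    unfolding absolute_length_def graph_dist_def
  proof (rule Least_equality)
    \<comment> \<open>The walk \<open>p\<close> was only bounded in length; \<open>lower\<close>
      together with \<open>fb\<close> turns the bound into an equality.\<close>
    show "\<exists>p. awalk ?b p x \<and> length p = f x"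
      using p lower[OF p(1)] fb by force
    show "f x \<le> k" if "\<exists>p. awalk ?b p x \<and> length p = k" for k
      using that lower fb by fastforce
  qed
qed

section \<open>Adding two points to the ground set\<close>

text \<open>For \<open>p\<close> in the old ground set, \<open>p\<close> becomes the partner of
  \<open>N\<close>, and \<open>M\<close> inherits the former partner of \<open>p\<close>. The choice
  \<open>p = M\<close> keeps \<open>{N, M}\<close> as an edge.\<close>

definition insert_pair :: "'a \<Rightarrow> 'a \<Rightarrow> 'a set set \<Rightarrow> 'a \<Rightarrow> 'a set set" where
  "insert_pair N M y p = swap p M (insert {N, M} y)"

context
  fixes S :: "'a set" and N M :: 'a
  assumes new: "N \<notin> S" "M \<notin> S" "N \<noteq> M"
begin

text \<open>The assumption makes the insertion proper: a \<open>y\<close> that already contained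
  \<open>{N, M}\<close> would be unchanged by it and could not be a matching of
  \<open>S\<close>.\<close>

lemma insert_edge_in_matchings_iff:
  assumes "{N, M} \<notin> y"
  shows "insert {N, M} y \<in> matchings (insert N (insert M S)) \<longleftrightarrow> y \<in> matchings S"
proof -
  have "partition_on (insert N (insert M S)) (insert {N, M} y) \<longleftrightarrow> partition_on S y"
    if "\<forall>e\<in>y. card e = 2"
  proof
    assume *: "partition_on (insert N (insert M S)) (insert {N, M} y)"
    then have U: "{N, M} \<union> \<Union>y = insert N (insert M S)"
      by (simp add: partition_on_def)
    have "\<forall>e\<in>y. disjnt {N, M} e"
      using * assms by (force simp: partition_on_def disjoint_def disjnt_def)
    then have "\<Union>y = S"
      using U new by (auto simp: disjnt_def)
    then show "partition_on S y"
      using * by (auto simp: partition_on_def disjoint_def)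
  next
    assume *: "partition_on S y"
    then show "partition_on (insert N (insert M S)) (insert {N, M} y)"
      using new by (auto simp: partition_on_def disjoint_def)
  qed
  then show ?thesis
    using new by (auto simp: matchings_def)
qed

lemma edge_notin_matching: "y \<in> matchings S \<Longrightarrow> {N, M} \<notin> y"
  using matchings_edgeD(2)[of y S N M] new by blast

lemma pair_in_insert_pair:
  assumes "p \<in> insert M S"
  shows "{N, p} \<in> insert_pair N M y p"
proof -
  have "transpose p M ` {N, M} = {N, p}"
    using assms new by (auto simp: transpose_def)
  then show ?thesis
    by (auto simp: insert_pair_def swap_insert)
qed

lemma insert_pair_in_matchings:
  assumes "y \<in> matchings S" "p \<in> insert M S"
  shows "insert_pair N M y p \<in> matchings (insert N (insert M S))"
proof -
  have "insert {N, M} y \<in> matchings (insert N (insert M S))"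
    using insert_edge_in_matchings_iff[OF edge_notin_matching[OF assms(1)]] assms(1) by blast
  then show ?thesis
    unfolding insert_pair_def using assms(2) by (intro swap_in_matchings) blast+
qed

text \<open>The point \<open>p\<close> is recovered as the partner of \<open>N\<close>; undoing the
  transposition and deleting \<open>{N, M}\<close> then recovers \<open>y\<close>.\<close>

lemma insert_pair_inject:
  assumes y: "y \<in> matchings S" "p \<in> insert M S" and y': "y' \<in> matchings S" "p' \<in> insert M S"
    and eq: "insert_pair N M y p = insert_pair N M y' p'"
  shows "y = y' \<and> p = p'"
proof -
  have "p = p'"
    using matchings_partner_unique[OF insert_pair_in_matchings[OF y]]
      pair_in_insert_pair[OF y(2)] pair_in_insert_pair[OF y'(2)] eq by metis
  then have "insert {N, M} y = insert {N, M} y'"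
    using eq unfolding insert_pair_def by (metis swap_swap)
  then show ?thesis
    using \<open>p = p'\<close> edge_notin_matching[OF y(1)] edge_notin_matching[OF y'(1)]
    by (metis insert_ident)
qed

text \<open>With \<open>p\<close> the partner of \<open>N\<close>, the transposition of
  \<open>p\<close> and \<open>M\<close> produces the edge \<open>{N, M}\<close>, and the remaining
  edges form \<open>y\<close>.\<close>

lemma insert_pair_surj:
  assumes x: "x \<in> matchings (insert N (insert M S))"
  obtains y p where "y \<in> matchings S" "p \<in> insert M S" "x = insert_pair N M y p"
proof -
  obtain p where p: "{N, p} \<in> x"
    using matchings_partner[OF x, of N] by auto
  have pS: "p \<in> insert M S"
    using matchings_edgeD[OF x p] by auto
  have "transpose p M ` {N, p} = {N, M}"
    using pS new by (auto simp: transpose_def)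
  then have NM: "{N, M} \<in> swap p M x"
    using p unfolding swap_def by (metis imageI)
  define y where "y = swap p M x - {{N, M}}"
  have ins: "insert {N, M} y = swap p M x"
    using NM by (auto simp: y_def)
  have "swap p M x \<in> matchings (insert N (insert M S))"
    using swap_in_matchings[OF x] pS by blast
  then have "y \<in> matchings S"
    using insert_edge_in_matchings_iff[of y] ins by (simp add: y_def)
  moreover have "x = insert_pair N M y p"
    by (simp add: insert_pair_def ins)
  ultimately show ?thesis using pS that by blast
qed

text \<open>Serves twice later: its inverse defines the rank function on the larger set, and it
  reindexes the generating sum.\<close>

lemma bij_betw_insert_pair:
  "bij_betw (\<lambda>(y, p). insert_pair N M y p) (matchings S \<times> insert M S)
     (matchings (insert N (insert M S)))"
  unfolding bij_betw_def
proof
  show "inj_on (\<lambda>(y, p). insert_pair N M y p) (matchings S \<times> insert M S)"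
    by (auto simp: inj_on_def dest: insert_pair_inject)
  show "(\<lambda>(y, p). insert_pair N M y p) ` (matchings S \<times> insert M S)
      = matchings (insert N (insert M S))"
    using insert_pair_in_matchings by (auto elim!: insert_pair_surj)
qed

text \<open>Only transpositions fixing \<open>N\<close> have to be examined, since the transposition of the
  two partners has the same effect.\<close>

lemma swap_insert_pair:
  assumes y: "y \<in> matchings S" and p: "p \<in> insert M S"
    and ac: "a \<in> insert N (insert M S)" "c \<in> insert N (insert M S)"
  obtains
    (old) a' c' p' where "a' \<in> S" "c' \<in> S" "p' \<in> insert M S" "p' = M \<longleftrightarrow> p = M"
      "swap a c (insert_pair N M y p) = insert_pair N M (swap a' c' y) p'"
  | (partner) q where "q \<in> insert M S"
      "swap a c (insert_pair N M y p) = insert_pair N M y q"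
proof -
  let ?x = "insert_pair N M y p"
  let ?thesis' = "(\<exists>a'\<in>S. \<exists>c'\<in>S. \<exists>p'\<in>insert M S. (p' = M \<longleftrightarrow> p = M) \<and>
        swap a c ?x = insert_pair N M (swap a' c' y) p') \<or>
      (\<exists>q\<in>insert M S. swap a c ?x = insert_pair N M y q)"
  have swap_NM: "swap b d (insert {N, M} y) = insert {N, M} (swap b d y)"
    if "b \<in> S" "d \<in> S" for b d
  proof -
    have "transpose b d ` {N, M} = {N, M}"
      using that new by (auto simp: transpose_def)
    then show ?thesis by (simp add: swap_insert)
  qed
  \<comment> \<open>If \<open>p\<close> is \<open>M\<close> or \<open>b\<close>, only the partner of
    \<open>N\<close> changes, to \<open>b\<close> or \<open>M\<close> respectively. Otherwise
    \<open>swap b M\<close> can be moved inside \<open>swap p M\<close>, where it becomes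
    \<open>swap b p\<close> acting on \<open>y\<close>.\<close>
  have swap_M: "(\<exists>a'\<in>S. \<exists>c'\<in>S. p \<noteq> M \<and> swap b M ?x = insert_pair N M (swap a' c' y) p) \<or>
      (\<exists>q\<in>insert M S. swap b M ?x = insert_pair N M y q)" if b: "b \<in> S" for b
  proof -
    consider "p = M" | "p = b" | "p \<in> S" "p \<noteq> b" "p \<noteq> M" using p new by blast
    then show ?thesis
    proof cases
      case 1
      then have "swap b M ?x = insert_pair N M y b" by (simp add: insert_pair_def)
      then show ?thesis using b by blast
    next
      case 2
      then have "swap b M ?x = insert_pair N M y M" by (simp add: insert_pair_def)
      then show ?thesis by blast
    next
      case 3
      have "swap p M (swap b p (insert {N, M} y)) = swap b M (swap p M (insert {N, M} y))"
      proof -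
        have "transpose p M (transpose b p z) = transpose b M (transpose p M z)" for z
          using 3 b new by (auto simp: transpose_def)
        then show ?thesis by (simp add: swap_def image_image)
      qed
      then have "swap b M ?x = insert_pair N M (swap b p y) p"
        using swap_NM b 3 by (simp add: insert_pair_def)
      then show ?thesis using b 3 by blast
    qed
  qed
  have "?thesis'"
    using insert_pair_in_matchings[OF y p] ac
  proof (cases rule: swap_avoiding[where u = N])
    case 1
    then show ?thesis using p by auto
  next
    case (2 b d)
    consider "b \<in> S" "d \<in> S" | "b \<in> S" "d = M" | "b = M" "d \<in> S" | "b = M" "d = M"
      using 2 by auto
    then show ?thesis
    proof cases
      case 1
      \<comment> \<open>A transposition inside \<open>S\<close> fixes \<open>M\<close>, so
        conjugation sends the partner \<open>p\<close> to its image and acts on \<open>y\<close>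
        directly.\<close>
      have "swap b d ?x = swap (transpose b d p) (transpose b d M) (swap b d (insert {N, M} y))"
        unfolding insert_pair_def by (rule swap_conjugate)
      also have "transpose b d M = M"
        using 1 new by (auto simp: transpose_def)
      finally have "swap b d ?x = insert_pair N M (swap b d y) (transpose b d p)"
        using swap_NM 1 by (simp add: insert_pair_def)
      moreover have "transpose b d p \<in> insert M S" "transpose b d p = M \<longleftrightarrow> p = M"
        using 1 p new by (auto simp: transpose_def)
      ultimately show ?thesis using 1 2 by metis
    next
      case 2
      then show ?thesis using swap_M \<open>swap a c ?x = _\<close> p by metis
    next
      case 3
      then show ?thesis using swap_M \<open>swap a c ?x = _\<close> p swap_commute by metis
    next
      case 4
      then show ?thesis using \<open>swap a c ?x = _\<close> p by auto
    qed
  qed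
  then show thesis using old partner by blast
qed

text \<open>By \<open>swap_insert_pair\<close>, a transposition affects only one of the two
  summands: in case \<open>old\<close> the summand for \<open>p\<close> is kept, in case
  \<open>partner\<close> the matching \<open>y\<close> is. Hence the value rises by at most
  one.\<close>

lemma swap_rank_insert_pair:
  assumes f: "swap_rank S b f"
    and g: "\<And>y p. y \<in> matchings S \<Longrightarrow> p \<in> insert M S \<Longrightarrow>
      g (insert_pair N M y p) = f y + of_bool (p \<noteq> M)"
  shows "swap_rank (insert N (insert M S)) (insert {N, M} b) g"
proof -
  let ?S = "insert N (insert M S)"
  have b: "b \<in> matchings S" and f0: "\<And>y. y \<in> matchings S \<Longrightarrow> f y = 0 \<longleftrightarrow> y = b"
    and f1: "\<And>y a c. y \<in> matchings S \<Longrightarrow> a \<in> S \<Longrightarrow> c \<in> S \<Longrightarrow> f (swap a c y) \<le> f y + 1"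
    and f2: "\<And>y. y \<in> matchings S \<Longrightarrow> f y > 0 \<Longrightarrow> \<exists>a\<in>S. \<exists>c\<in>S. f (swap a c y) < f y"
    using f by (simp_all add: swap_rank_def)
  have insert_pair_M: "insert_pair N M y M = insert {N, M} y" for y
    by (simp add: insert_pair_def)
  have "insert {N, M} b \<in> matchings ?S"
    using insert_pair_in_matchings[OF b, of M] by (simp add: insert_pair_M)
  moreover have "(g x = 0 \<longleftrightarrow> x = insert {N, M} b) \<and>
      (\<forall>a\<in>?S. \<forall>c\<in>?S. g (swap a c x) \<le> g x + 1) \<and>
      (g x > 0 \<longrightarrow> (\<exists>a\<in>?S. \<exists>c\<in>?S. g (swap a c x) < g x))"
    if "x \<in> matchings ?S" for x
  proof -
    obtain y p where y: "y \<in> matchings S" and p: "p \<in> insert M S"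
      and x: "x = insert_pair N M y p"
      using insert_pair_surj \<open>x \<in> matchings ?S\<close> by blast
    have "g x = 0 \<longleftrightarrow> x = insert {N, M} b"
      using insert_pair_inject[OF y p b, of M] f0[OF y]
      by (auto simp: x g[OF y p] insert_pair_M)
    moreover have "g (swap a c x) \<le> g x + 1" if ac: "a \<in> ?S" "c \<in> ?S" for a c
      using y p ac
    proof (cases rule: swap_insert_pair)
      case (old a' c' p')
      then show ?thesis
        using f1[OF y old(1,2)] g[OF y p] g[OF swap_in_matchings[OF y old(1,2)] old(3)]
        by (simp add: x)
    next
      case (partner q)
      then show ?thesis using g[OF y p] g[OF y partner(1)] by (simp add: x)
    qed
    moreover have "\<exists>a\<in>?S. \<exists>c\<in>?S. g (swap a c x) < g x" if "g x > 0"
    \<comment> \<open>For \<open>p = M\<close> the descent comes from \<open>y\<close>, by a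
      transposition fixing \<open>N\<close> and \<open>M\<close>. Otherwise restoring the edge
      \<open>{N, M}\<close> saves one.\<close>
    proof (cases "p = M")
      case True
      then have "f y > 0" using that by (simp add: x g y)
      then obtain a c where ac: "a \<in> S" "c \<in> S" "f (swap a c y) < f y"
        using f2[OF y] by blast
      have "transpose a c ` {N, M} = {N, M}"
        using ac new by (auto simp: transpose_def)
      then have "swap a c x = insert_pair N M (swap a c y) M"
        by (simp add: x True insert_pair_M swap_insert)
      then have "g (swap a c x) < g x"
        using ac swap_in_matchings[OF y ac(1,2)] by (simp add: x g y True)
      then show ?thesis using ac by blast
    next
      case False
      have "swap p M x = insert_pair N M y M"
        by (simp add: x insert_pair_def)
      then have "g (swap p M x) < g x"
        using False g[OF y p] g[OF y, of M] by (simp add: x)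
      then show ?thesis using p by blast
    qed
    ultimately show ?thesis by blast
  qed
  ultimately show ?thesis
    unfolding swap_rank_def by (rule conjI[OF _ ballI])
qed

text \<open>Each \<open>y\<close> contributes its old monomial once for \<open>p = M\<close> and,
  raised by one degree, once for each \<open>p\<close> in \<open>S\<close>; this is the factor
  \<open>1 + card S * q\<close>.\<close>

lemma ex_swap_rank_insert_pair:
  assumes f: "swap_rank S b f" and fin: "finite S"
  obtains g where "swap_rank (insert N (insert M S)) (insert {N, M} b) g"
    "(\<Sum>x\<in>matchings (insert N (insert M S)). monom 1 (g x)) =
      (\<Sum>y\<in>matchings S. monom 1 (f y)) * [:1, of_nat (card S) :: 'b::comm_ring_1:]"
proof -
  let ?S = "insert N (insert M S)" and ?h = "\<lambda>(y, p). insert_pair N M y p"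
  \<comment> \<open>The pair \<open>(y, p)\<close> is read off from \<open>x\<close> by the inverse
    of the bijection; values outside the matchings of \<open>?S\<close> do not matter.\<close>
  define g where "g x = (case the_inv_into (matchings S \<times> insert M S) ?h x of
      (y, p) \<Rightarrow> f y + of_bool (p \<noteq> M))" for x
  have g: "g (insert_pair N M y p) = f y + of_bool (p \<noteq> M)"
    if "y \<in> matchings S" "p \<in> insert M S" for y p
    using that the_inv_into_f_f[OF bij_betw_imp_inj_on[OF bij_betw_insert_pair], of "(y, p)"]
    by (simp add: g_def)
  have "(\<Sum>x\<in>matchings ?S. monom (1::'b) (g x)) =
      (\<Sum>(y, p)\<in>matchings S \<times> insert M S. monom 1 (g (insert_pair N M y p)))"
    by (subst sum.reindex_bij_betw[OF bij_betw_insert_pair, symmetric]) (simp add: case_prod_unfold)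
  also have "\<dots> = (\<Sum>y\<in>matchings S. \<Sum>p\<in>insert M S. monom 1 (f y + of_bool (p \<noteq> M)))"
    by (simp add: sum.cartesian_product[symmetric] g)
  also have "\<dots> = (\<Sum>y\<in>matchings S. monom 1 (f y) * [:1, of_nat (card S):])"
  proof (rule sum.cong[OF refl])
    fix y assume "y \<in> matchings S"
    have "(\<Sum>p\<in>S. monom (1::'b) (f y + of_bool (p \<noteq> M))) = (\<Sum>p\<in>S. monom 1 (f y + 1))"
      using new by (intro sum.cong) auto
    then have "(\<Sum>p\<in>insert M S. monom (1::'b) (f y + of_bool (p \<noteq> M))) =
        monom 1 (f y) * (1 + of_nat (card S) * monom 1 1)"
      using fin new by (simp add: algebra_simps mult_monom)
    also have "1 + of_nat (card S) * monom 1 1 = [:1, of_nat (card S) :: 'b:]"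
      by (simp add: monom_altdef of_nat_poly one_pCons)
    finally show "(\<Sum>p\<in>insert M S. monom (1::'b) (f y + of_bool (p \<noteq> M))) =
        monom 1 (f y) * [:1, of_nat (card S):]" .
  qed
  finally show thesis
    using that[OF swap_rank_insert_pair[OF f g]] by (simp only: sum_distrib_right)
qed

end

section \<open>Induction on \<open>n\<close> and the product formula\<close>

lemma Omega_Suc:
  "Omega (Suc n) = insert (int (Suc n)) (insert (- int (Suc n)) (Omega n))"
  by (auto simp: Omega_def)

lemma base_matching_Suc:
  "base_matching (Suc n) = insert {int (Suc n), - int (Suc n)} (base_matching n)"
proof -
  have "{1..int (Suc n)} = insert (int (Suc n)) {1..int n}" by auto
  then show ?thesis by (simp add: base_matching_def insert_commute)
qed

lemma card_Omega: "card (Omega n) = 2 * n"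
  unfolding Omega_def by (subst card_Un_disjoint) auto

text \<open>The rank function and its generating polynomial are built in the same induction, since
  the product recursion concerns the particular \<open>g\<close> obtained from
  \<open>f\<close>.\<close>

lemma ex_swap_rank_Omega:
  "\<exists>f. swap_rank (Omega n) (base_matching n) f \<and>
    (\<Sum>x\<in>matchings (Omega n). monom 1 (f x)) = (\<Prod>i<n. [:1, 2 * int i:])"
proof (induction n)
  case 0
  \<comment> \<open>The empty set has exactly one matching, the empty one, which accounts for the
    empty product.\<close>
  have "matchings (Omega 0) = {{}}"
    by (auto simp: matchings_def Omega_def partition_on_def)
  then have "swap_rank (Omega 0) (base_matching 0) (\<lambda>_. 0)"
    by (simp add: swap_rank_def base_matching_def Omega_def)
  then show ?case using \<open>matchings (Omega 0) = {{}}\<close> by (intro exI[of _ "\<lambda>_. 0"]) simp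
next
  case (Suc n)
  then obtain f where f: "swap_rank (Omega n) (base_matching n) f"
    and sum: "(\<Sum>x\<in>matchings (Omega n). monom 1 (f x)) = (\<Prod>i<n. [:1, 2 * int i:])"
    by blast
  have new: "int (Suc n) \<notin> Omega n" "- int (Suc n) \<notin> Omega n" "int (Suc n) \<noteq> - int (Suc n)"
    and fin: "finite (Omega n)"
    by (auto simp: Omega_def)
  obtain g where g: "swap_rank (Omega (Suc n)) (base_matching (Suc n)) g"
    and "(\<Sum>x\<in>matchings (Omega (Suc n)). monom 1 (g x)) =
      (\<Sum>y\<in>matchings (Omega n). monom 1 (f y)) * [:1, of_nat (card (Omega n)) :: int:]"
    \<comment> \<open>Here \<open>N\<close> is \<open>int (Suc n)\<close> and \<open>M\<close> is
      its negative, so the added edge \<open>{N, M}\<close> is the new edge of the base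
      matching.\<close>
    by (rule ex_swap_rank_insert_pair[OF new f fin, folded Omega_Suc base_matching_Suc])
  then have "(\<Sum>x\<in>matchings (Omega (Suc n)). monom 1 (g x)) = (\<Prod>i<Suc n. [:1, 2 * int i:])"
    by (simp only: sum card_Omega prod.lessThan_Suc of_nat_mult of_nat_numeral)
  with g show ?case by blast
qed

theorem corollary4p14:
  fixes n :: nat
  assumes "n \<ge> 1"
  shows "rank_generating_poly n = (\<Prod>i<n. [:1, 2 * int i:])"
proof -
  obtain f where f: "swap_rank (Omega n) (base_matching n) f"
    and sum: "(\<Sum>x\<in>matchings (Omega n). monom 1 (f x)) = (\<Prod>i<n. [:1, 2 * int i:])"
    using ex_swap_rank_Omega by blast
  have "rank_generating_poly n = (\<Sum>x\<in>perfect_matchings n. monom 1 (f x))"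
    using absolute_length_eq_swap_rank[OF f] by (simp add: rank_generating_poly_def)
  also have "perfect_matchings n = matchings (Omega n)"
    by (simp add: perfect_matchings_def matchings_def)
  finally show ?thesis using sum by simp
qed

end
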